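(* Let $X=(X_t)_{t\ge 0}$ and $Y=(Y_t)_{t\ge 0}$ be stochastic processes with values in $E=\{e_1,\dots,e_n\}$ and $F=\{f_1,\dots,f_m\}$ respectively, let $W_{t}=Y_{t-1}\otimes X_{t}$ for $t\ge 1$, and suppose that $W$ is $\mathbb{G}$-Markov with transition matrix $R=\bar R(\mathbf{1}_m^\top\otimes I_n)$, where $\bar R\in\mathbb{R}^{nm\times n}$ is the matrix with stacked blocks $R_1,\dots,R_m\in\mathbb{R}^{n\times n}$; precisely, $E[W_{t+1}|\mathcal{G}_t]=\bar RX_t$ for all $t\ge0$. Then the predictor $\hat X_{t|t-1}=E[X_t|\mathcal{F}^Y_{t-1}]$ satisfies, almost surely for all $t\ge0$, the recursion $$\hat X_{t+1|t}=\left[\frac{R_1\hat X_{t|t-1}}{\mathbf{1}_n^\top R_1\hat X_{t|t-1}}\ \cdots\ \frac{R_m\hat X_{t|t-1}}{\mathbf{1}_n^\top R_m\hat X_{t|t-1}}\right]Y_t,$$ with initial condition $\hat X_{0|-1}=EX_0$. For the filter $\hat X_t=E[X_t|\mathcal{F}^Y_t]$ and for $\hat Y_{t+1|t}=E[Y_{t+1}|\mathcal{F}^Y_t]$ the following relations hold almost surely for all $t\ge 0$: $$\hat X_{t+1}=\mathrm{diag}(\hat X_{t+1|t})\,G^\top\,\mathrm{diag}(\hat Y_{t+1|t})^{-1}Y_{t+1},\qquad \hat Y_{t+1|t}=G\hat X_{t+1|t},$$ where $G=(I_m\otimes\mathbf{1}_n^\top)\bar R$.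
   Context: All random variables live on a probability space $(\Omega,\mathcal{F},P)$; equalities of conditional expectations hold almost surely. $e_1,\dots,e_n$ are the standard basis vectors of $\mathbb{R}^n$ and $f_1,\dots,f_m$ those of $\mathbb{R}^m$; $\otimes$ is the Kronecker product, $I_m$ the $m\times m$ identity matrix, $\mathbf{1}_n$ the column vector of $n$ ones. $\mathcal{G}_t=\sigma\{X_0,\dots,X_t,Y_0,\dots,Y_{t-1}\}$, $\mathbb{G}=\{\mathcal{G}_t\}$, $\mathcal{F}^Y_t=\sigma\{Y_0,\dots,Y_t\}$, $\mathcal{F}^Y_{-1}$ trivial. The blocks have the interpretation $R_iX_t=E[X_{t+1}1_{\{Y_t=f_i\}}|\mathcal{G}_t]$. $\mathrm{diag}(v)$ is the diagonal matrix with the entries of $v$ on the diagonal. The bracket in the recursion is the $n\times m$ matrix with the displayed columns. Convention on zeros: a column with zero denominator may be given any value (e.g. zero), and in $\mathrm{diag}(v)^{-1}$ the inverse of a zero diagonal entry may be given any value (e.g. zero), since almost surely the vector $Y_t$ (resp. $Y_{t+1}$) does not select such an entry. *)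

theory Defs
  imports "HOL-Probability.Probability"
begin

section \<open>Matrices\<close>

text \<open>Kronecker products are indexed by pairs, the first component being the block index; so a
  vector in \<open>real ^ ('m \<times> 'n)\<close> consists of \<open>CARD('m)\<close> stacked blocks of length \<open>CARD('n)\<close>.\<close>

definition kron :: "real ^ 'b ^ 'a \<Rightarrow> real ^ 'd ^ 'c \<Rightarrow> real ^ ('b \<times> 'd) ^ ('a \<times> 'c)" where
  "kron A B = (\<chi> i j. A $ fst i $ fst j * B $ snd i $ snd j)"

definition kron_vec :: "real ^ 'a \<Rightarrow> real ^ 'c \<Rightarrow> real ^ ('a \<times> 'c)" where
  "kron_vec u v = (\<chi> i. u $ fst i * v $ snd i)"

text \<open>Identifications of the index types \<open>1 \<times> 'n\<close> with \<open>'n\<close> and \<open>'m \<times> 1\<close> with \<open>'m\<close>, needed for the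
  rows of a Kronecker product with a row vector.\<close>

definition drop_unit_fst :: "'b ^ (1 \<times> 'n) \<Rightarrow> 'b ^ 'n" where
  "drop_unit_fst A = (\<chi> i. A $ (1, i))"

definition drop_unit_snd :: "'b ^ ('m \<times> 1) \<Rightarrow> 'b ^ 'm" where
  "drop_unit_snd A = (\<chi> i. A $ (i, 1))"

definition ones_kron_id :: "real ^ ('m::finite \<times> 'n::finite) ^ 'n" where
  "ones_kron_id = drop_unit_fst (kron (rowvector (1 :: real ^ 'm)) (mat 1 :: real ^ 'n ^ 'n))"

definition id_kron_ones :: "real ^ ('m::finite \<times> 'n::finite) ^ 'm" where
  "id_kron_ones = drop_unit_snd (kron (mat 1 :: real ^ 'm ^ 'm) (rowvector (1 :: real ^ 'n)))"

definition stack_blocks :: "('m::finite \<Rightarrow> real ^ 'n ^ 'n) \<Rightarrow> real ^ 'n ^ ('m \<times> 'n)" where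
  "stack_blocks R = (\<chi> i. R (fst i) $ snd i)"

definition diag :: "real ^ 'n \<Rightarrow> real ^ 'n ^ 'n" where
  "diag v = (\<chi> i j. if i = j then v $ i else 0)"

text \<open>Inverse of \<open>diag v\<close>, where \<open>d\<close> supplies the inverses of the zero diagonal entries.\<close>

definition diag_inv :: "real ^ 'n \<Rightarrow> real ^ 'n \<Rightarrow> real ^ 'n ^ 'n" where
  "diag_inv d v = diag (\<chi> i. if v $ i = 0 then d $ i else inverse (v $ i))"

text \<open>The matrix with columns \<open>R j *v x\<close>, each divided by the sum of its entries; \<open>c\<close> supplies the
  columns for which this sum is zero.\<close>

definition normalized_columns ::
    "real ^ 'm ^ 'n \<Rightarrow> ('m::finite \<Rightarrow> real ^ 'n ^ 'n) \<Rightarrow> real ^ 'n \<Rightarrow> real ^ 'm ^ 'n" where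
  "normalized_columns c R x =
     (\<chi> i j. if 1 \<bullet> (R j *v x) = 0 then c $ i $ j
             else (R j *v x) $ i / (1 \<bullet> (R j *v x)))"

section \<open>Conditional expectations and filtrations\<close>

definition vec_cond_exp :: "'a measure \<Rightarrow> 'a measure \<Rightarrow> ('a \<Rightarrow> real ^ 'n) \<Rightarrow> 'a \<Rightarrow> real ^ 'n" where
  "vec_cond_exp M F Z = (\<lambda>\<omega>. \<chi> i. real_cond_exp M F (\<lambda>\<omega>'. Z \<omega>' $ i) \<omega>)"

text \<open>The sigma-algebra generated by \<open>X\<^sub>0, \<dots>, X\<^sub>t, Y\<^sub>0, \<dots>, Y\<^sub>t\<^sub>-\<^sub>1\<close>.\<close>

definition joint_alg ::
    "'a measure \<Rightarrow> (nat \<Rightarrow> 'a \<Rightarrow> real ^ 'n) \<Rightarrow> (nat \<Rightarrow> 'a \<Rightarrow> real ^ 'm) \<Rightarrow> nat \<Rightarrow> 'a measure" where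
  "joint_alg M X Y t = sigma (space M)
     ({X s -` A \<inter> space M | s A. s \<le> t \<and> A \<in> sets borel} \<union>
      {Y s -` A \<inter> space M | s A. s < t \<and> A \<in> sets borel})"

text \<open>The time index is an integer, so that the trivial sigma-algebra is the one at time \<open>-1\<close>.\<close>

definition obs_alg :: "'a measure \<Rightarrow> (nat \<Rightarrow> 'a \<Rightarrow> real ^ 'm) \<Rightarrow> int \<Rightarrow> 'a measure" where
  "obs_alg M Y k = sigma (space M) {Y s -` A \<inter> space M | s A. int s \<le> k \<and> A \<in> sets borel}"

lemma sets_obs_alg_minus_one: "sets (obs_alg M Y (- 1)) = {{}, space M}"
proof -
  have "{Y s -` A \<inter> space M | s A. int s \<le> - 1 \<and> A \<in> sets borel} = {}"
    by auto
  then show ?thesis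
    by (simp add: obs_alg_def sigma_sets_empty_eq)
qed

text \<open>\<open>(W\<^sub>t)\<close>, \<open>t \<ge> t\<^sub>0\<close>, is Markov with respect to the filtration \<open>H\<close>. Vectors of probabilities are
  columns, hence the multiplication by \<open>R\<close> from the left.\<close>

definition markov_wrt ::
    "'a measure \<Rightarrow> (nat \<Rightarrow> 'a measure) \<Rightarrow> nat \<Rightarrow> (nat \<Rightarrow> 'a \<Rightarrow> real ^ 'k) \<Rightarrow> real ^ 'k ^ 'k \<Rightarrow> bool" where
  "markov_wrt M H t0 W R \<longleftrightarrow>
     (\<forall>t\<ge>t0. W t \<in> borel_measurable (H t) \<and>
       (AE \<omega> in M. vec_cond_exp M (H t) (W (Suc t)) \<omega> = R *v W t \<omega>))"

end

theory Submission
  imports Defs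
begin

text \<open>Everything rests on Bayes' formula for a \<open>\<sigma>\<close>-algebra enlarged by a discrete observation: on the
  event \<open>Y\<^sub>t = f\<^sub>j\<close> one has \<open>E[Z|F\<^sup>Y\<^sub>t] E[Y\<^sub>t\<^sub>j|F\<^sup>Y\<^sub>t\<^sub>-\<^sub>1] = E[Y\<^sub>t\<^sub>j Z|F\<^sup>Y\<^sub>t\<^sub>-\<^sub>1]\<close>, because \<open>F\<^sup>Y\<^sub>t\<close> and \<open>F\<^sup>Y\<^sub>t\<^sub>-\<^sub>1\<close> have
  the same trace on this event, and the second factor is almost surely nonzero there. The other two
  conditional expectations are linear in the predictor by the tower property: for the predictor take
  \<open>Z = X\<^sub>t\<^sub>+\<^sub>1\<close>; for the filter at time \<open>t + 1\<close> take \<open>Z = X\<^sub>t\<^sub>+\<^sub>1\<close> and use that \<open>X\<^sub>t\<^sub>+\<^sub>1\<close> is known at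
  time \<open>t + 1\<close> and is a basis vector, so that its \<open>i\<close>-th entry times \<open>(G X\<^sub>t\<^sub>+\<^sub>1)\<^sub>j\<close> is this entry times \<open>G\<^sub>j\<^sub>i\<close>.\<close>

section \<open>Bayes' formula\<close>

lemma (in prob_space) sigma_finite_subalgebra:
  assumes "subalgebra M F"
  shows "sigma_finite_subalgebra M F"
  using assms finite_measure_axioms
  by (intro finite_measure_subalgebra_is_sigma_finite)
     (simp add: finite_measure_subalgebra_def finite_measure_subalgebra_axioms_def)

context prob_space
begin

context
  fixes F F' :: "'a measure" and u :: "'a \<Rightarrow> real"
  assumes FF': "subalgebra M F'" "subalgebra F' F"
    and u_meas: "u \<in> borel_measurable F'"
    and u_01: "\<And>\<omega>. \<omega> \<in> space M \<Longrightarrow> u \<omega> \<in> {0, 1}"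
begin

private lemma subalg: "subalgebra M F" "sigma_finite_subalgebra M F" "sigma_finite_subalgebra M F'"
proof -
  show "subalgebra M F"
    using FF' by (auto simp: subalgebra_def)
  then show "sigma_finite_subalgebra M F" "sigma_finite_subalgebra M F'"
    using FF' sigma_finite_subalgebra by auto
qed

private lemma u_M [measurable]: "u \<in> borel_measurable M"
  using u_meas FF'(1) measurable_from_subalg by blast

private lemma u_int: "integrable M u"
  using u_01 by (intro integrable_const_bound[of _ 1] AE_I2) fastforce+

text \<open>The set \<open>Z\<close> where the conditional probability vanishes belongs to
  \<open>F\<close>, so \<open>u\<close> has integral zero over it; being nonnegative,
  \<open>u\<close> is almost surely zero there. This is why default values at zero denominators
  never matter.\<close>

lemma cond_exp_event_nonzero:
  "AE \<omega> in M. u \<omega> = 1 \<longrightarrow> real_cond_exp M F u \<omega> \<noteq> 0"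
proof -
  interpret F: sigma_finite_subalgebra M F by (rule subalg)
  define Z where "Z = {\<omega> \<in> space F. real_cond_exp M F u \<omega> = 0}"
  have ZF: "Z \<in> sets F" unfolding Z_def by measurable
  then have [measurable]: "Z \<in> sets M" using subalg by (auto simp: subalgebra_def)
  have "(\<integral>\<omega>\<in>Z. u \<omega> \<partial>M) = (\<integral>\<omega>\<in>Z. real_cond_exp M F u \<omega> \<partial>M)"
    by (rule F.real_cond_exp_intA[OF u_int ZF])
  also have "\<dots> = 0"
    unfolding set_lebesgue_integral_def
    by (intro integral_eq_zero_AE AE_I2) (auto simp: Z_def indicator_def)
  finally have eq: "(\<integral>\<omega>. indicator Z \<omega> * u \<omega> \<partial>M) = 0"
    by (simp add: set_lebesgue_integral_def)
  have "integrable M (\<lambda>\<omega>. indicator Z \<omega> * u \<omega>)"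
    using integrable_mult_indicator[OF _ u_int, of Z] by simp
  moreover have "AE \<omega> in M. 0 \<le> indicator Z \<omega> * u \<omega>"
    using u_01 by (intro AE_I2) (fastforce simp: indicator_def)
  ultimately have "AE \<omega> in M. indicator Z \<omega> * u \<omega> = 0"
    using eq integral_nonneg_eq_0_iff_AE by blast
  then show ?thesis
    using AE_space
  proof eventually_elim
    case (elim \<omega>)
    then show ?case
      using subalg(1) by (auto simp: Z_def indicator_def subalgebra_def)
  qed
qed

text \<open>The product form avoids division. Hypothesis \<open>trace\<close> lets any test set of
  \<open>F'\<close> be traded for one of \<open>F\<close> as long as the factor \<open>u\<close> is
  present; the rest is moving \<open>F\<close>-conditional expectations across an integral.\<close>

lemma cond_exp_Bayes:
  assumes trace: "\<And>A. A \<in> sets F' \<Longrightarrow>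
      \<exists>B\<in>sets F. \<forall>\<omega>\<in>space M. u \<omega> = 1 \<longrightarrow> (\<omega> \<in> A \<longleftrightarrow> \<omega> \<in> B)"
    and Z: "integrable M Z"
  shows "AE \<omega> in M. u \<omega> = 1 \<longrightarrow>
      real_cond_exp M F' Z \<omega> * real_cond_exp M F u \<omega> = real_cond_exp M F (\<lambda>\<omega>. u \<omega> * Z \<omega>) \<omega>"
proof -
  interpret F: sigma_finite_subalgebra M F by (rule subalg)
  interpret F': sigma_finite_subalgebra M F' by (rule subalg)
  define D where "D = real_cond_exp M F u"
  define N where "N = real_cond_exp M F (\<lambda>\<omega>. u \<omega> * Z \<omega>)"
  have DNF [measurable]: "D \<in> borel_measurable F" "N \<in> borel_measurable F"
    and [measurable]: "D \<in> borel_measurable M" "N \<in> borel_measurable M"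
    by (simp_all add: D_def N_def)
  have [measurable]: "Z \<in> borel_measurable M" using Z by simp
  note u_meas [measurable]
  have DNF' [measurable]: "D \<in> borel_measurable F'" "N \<in> borel_measurable F'"
    using measurable_from_subalg[OF FF'(2)] DNF by blast+
  \<comment> \<open>The bounds on \<open>D\<close> and \<open>u\<close> keep all products below
    integrable, although \<open>Z\<close> itself is only assumed integrable.\<close>
  have "AE \<omega> in M. D \<omega> \<ge> 0" "AE \<omega> in M. D \<omega> \<le> 1"
    unfolding D_def using u_01 u_int
    by (intro F.real_cond_exp_ge_c F.real_cond_exp_le_c AE_I2; fastforce)+
  then have D_bound: "AE \<omega> in M. \<bar>D \<omega>\<bar> \<le> 1" by eventually_elim simp
  have u_bound: "AE \<omega> in M. \<bar>u \<omega>\<bar> \<le> 1" using u_01 by (intro AE_I2) fastforce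
  have int_mult: "integrable M (\<lambda>\<omega>. f \<omega> * g \<omega>)"
    if "integrable M g" "f \<in> borel_measurable M" "AE \<omega> in M. \<bar>f \<omega>\<bar> \<le> 1" for f g :: "'a \<Rightarrow> real"
    using that
    by (intro Bochner_Integration.integrable_bound[OF that(1)])
       (auto simp: abs_mult elim!: eventually_mono intro: mult_left_le_one_le)
  have uZ: "integrable M (\<lambda>\<omega>. u \<omega> * Z \<omega>)" by (rule int_mult[OF Z u_M u_bound])
  have N_int: "integrable M N" unfolding N_def by (rule F.real_cond_exp_int[OF uZ])
  have uN: "integrable M (\<lambda>\<omega>. u \<omega> * N \<omega>)" by (rule int_mult[OF N_int u_M u_bound])
  have DuZ: "integrable M (\<lambda>\<omega>. D \<omega> * (u \<omega> * Z \<omega>))" by (rule int_mult[OF uZ _ D_bound]) simp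
  then have uDZ: "integrable M (\<lambda>\<omega>. (u \<omega> * D \<omega>) * Z \<omega>)" by (simp add: mult_ac)
  \<comment> \<open>The key identity: \<open>u * N\<close> is \<open>F'\<close>-measurable, and it
    remains to compare integrals over sets of \<open>F'\<close>.\<close>
  have "AE \<omega> in M. real_cond_exp M F' (\<lambda>\<omega>. (u \<omega> * D \<omega>) * Z \<omega>) \<omega> = u \<omega> * N \<omega>"
  proof (rule F'.real_cond_exp_charact[OF _ uDZ uN])
    fix A assume A: "A \<in> sets F'"
    obtain B where B: "B \<in> sets F"
      and AB: "\<And>\<omega>. \<omega> \<in> space M \<Longrightarrow> u \<omega> = 1 \<Longrightarrow> \<omega> \<in> A \<longleftrightarrow> \<omega> \<in> B"
      using trace[OF A] by blast
    note B [measurable]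
    have [measurable]: "B \<in> sets M" using B subalg by (auto simp: subalgebra_def)
    have AB_u: "indicator A \<omega> * u \<omega> = indicator B \<omega> * u \<omega>" if "\<omega> \<in> space M" for \<omega>
      using AB[OF that] u_01[OF that] by (auto simp: indicator_def)
    have ind: "integrable M (\<lambda>\<omega>. indicator B \<omega> * f \<omega>)" if "integrable M f" for f :: "'a \<Rightarrow> real"
      using integrable_mult_indicator[OF _ that, of B] by simp
    have "(\<integral>\<omega>\<in>A. (u \<omega> * D \<omega>) * Z \<omega> \<partial>M) = (\<integral>\<omega>. (indicator B \<omega> * D \<omega>) * (u \<omega> * Z \<omega>) \<partial>M)"
      unfolding set_lebesgue_integral_def real_scaleR_def
      by (rule Bochner_Integration.integral_cong[OF refl]) (use AB_u in \<open>simp add: algebra_simps\<close>)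
    \<comment> \<open>Both \<open>D\<close> and \<open>N\<close> are \<open>F\<close>-measurable, so
      first \<open>u * Z\<close> is replaced by \<open>N\<close> against the weight
      \<open>D\<close>, then \<open>D\<close> is replaced by \<open>u\<close> against the weight
      \<open>N\<close>.\<close>
    also have "\<dots> = (\<integral>\<omega>. (indicator B \<omega> * D \<omega>) * N \<omega> \<partial>M)"
      unfolding N_def
      by (rule F.real_cond_exp_intg(2)[symmetric]) (use ind[OF DuZ] in \<open>auto simp: mult_ac\<close>)
    also have "\<dots> = (\<integral>\<omega>. (indicator B \<omega> * N \<omega>) * D \<omega> \<partial>M)"
      by (simp add: mult_ac)
    also have "\<dots> = (\<integral>\<omega>. (indicator B \<omega> * N \<omega>) * u \<omega> \<partial>M)"
      unfolding D_def
      by (rule F.real_cond_exp_intg(2)) (use ind[OF uN] in \<open>auto simp: mult_ac\<close>)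
    also have "\<dots> = (\<integral>\<omega>\<in>A. u \<omega> * N \<omega> \<partial>M)"
      unfolding set_lebesgue_integral_def real_scaleR_def
      by (rule Bochner_Integration.integral_cong[OF refl]) (metis AB_u mult.commute mult.left_commute)
    finally show "(\<integral>\<omega>\<in>A. (u \<omega> * D \<omega>) * Z \<omega> \<partial>M) = (\<integral>\<omega>\<in>A. u \<omega> * N \<omega> \<partial>M)" .
  qed measurable
  \<comment> \<open>The factor \<open>u * D\<close> is known to \<open>F'\<close>; once it is pulled
    out, restricting to \<open>u = 1\<close> leaves the claim.\<close>
  moreover have "AE \<omega> in M. real_cond_exp M F' (\<lambda>\<omega>. (u \<omega> * D \<omega>) * Z \<omega>) \<omega>
      = (u \<omega> * D \<omega>) * real_cond_exp M F' Z \<omega>"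
    by (rule F'.real_cond_exp_mult[OF _ _ uDZ]) measurable
  ultimately show ?thesis
    unfolding D_def [symmetric] N_def [symmetric] by eventually_elim (auto simp: mult.commute)
qed

end

end

lemma (in sigma_finite_subalgebra) cond_exp_matrix_vector_mult:
  fixes A :: "real ^ 'n ^ 'm"
  assumes Z: "\<And>k. integrable M (\<lambda>\<omega>. Z \<omega> $ k)"
  shows "AE \<omega> in M. real_cond_exp M F (\<lambda>\<omega>. (A *v Z \<omega>) $ i) \<omega> = (A *v vec_cond_exp M F Z \<omega>) $ i"
proof -
  have "AE \<omega> in M. real_cond_exp M F (\<lambda>\<omega>. \<Sum>k\<in>UNIV. A $ i $ k * Z \<omega> $ k) \<omega>
      = (\<Sum>k\<in>UNIV. real_cond_exp M F (\<lambda>\<omega>. A $ i $ k * Z \<omega> $ k) \<omega>)"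
    by (rule real_cond_exp_sum) (simp add: Z)
  moreover have "AE \<omega> in M. \<forall>k\<in>UNIV. real_cond_exp M F (\<lambda>\<omega>. A $ i $ k * Z \<omega> $ k) \<omega>
      = A $ i $ k * real_cond_exp M F (\<lambda>\<omega>. Z \<omega> $ k) \<omega>"
    by (intro AE_finite_allI real_cond_exp_cmult Z) simp
  ultimately show ?thesis
    by eventually_elim (simp add: matrix_vector_mult_def vec_cond_exp_def)
qed

section \<open>The two filtrations\<close>

lemma borel_measurable_vec_nth:
  fixes f :: "'a \<Rightarrow> real ^ 'n"
  assumes "f \<in> borel_measurable F"
  shows "(\<lambda>\<omega>. f \<omega> $ i) \<in> borel_measurable F"
  by (rule borel_measurable_continuous_on[OF _ assms]) (intro continuous_intros)

lemma space_obs_alg [simp]: "space (obs_alg M Y k) = space M"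
  by (simp add: obs_alg_def space_measure_of_conv)

lemma space_joint_alg [simp]: "space (joint_alg M X Y t) = space M"
  by (simp add: joint_alg_def space_measure_of_conv)

lemma sets_obs_alg:
  "sets (obs_alg M Y k) =
     sigma_sets (space M) {Y s -` A \<inter> space M | s A. int s \<le> k \<and> A \<in> sets borel}"
  unfolding obs_alg_def by (rule sets_measure_of) auto

lemma sets_joint_alg:
  "sets (joint_alg M X Y t) = sigma_sets (space M)
     ({X s -` A \<inter> space M | s A. s \<le> t \<and> A \<in> sets borel} \<union>
      {Y s -` A \<inter> space M | s A. s < t \<and> A \<in> sets borel})"
  unfolding joint_alg_def by (rule sets_measure_of) auto

lemma subalgebra_obs_alg:
  assumes "\<And>s. Y s \<in> borel_measurable M"
  shows "subalgebra M (obs_alg M Y k)"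
  unfolding subalgebra_def sets_obs_alg
  using assms by (auto intro!: sets.sigma_sets_subset measurable_sets)

lemma subalgebra_joint_alg:
  assumes "\<And>s. X s \<in> borel_measurable M" "\<And>s. Y s \<in> borel_measurable M"
  shows "subalgebra M (joint_alg M X Y t)"
  unfolding subalgebra_def sets_joint_alg
  using assms by (auto intro!: sets.sigma_sets_subset measurable_sets)

lemma subalgebra_obs_alg_mono:
  assumes "k \<le> l"
  shows "subalgebra (obs_alg M Y l) (obs_alg M Y k)"
  unfolding subalgebra_def sets_obs_alg using assms by (fastforce intro!: sigma_sets_mono')

text \<open>The joint history at time \<open>t\<close> records observations only up to
  \<open>t - 1\<close>; for \<open>t = 0\<close> the integer index gives the trivial
  algebra.\<close>

lemma subalgebra_joint_obs_alg: "subalgebra (joint_alg M X Y t) (obs_alg M Y (int t - 1))"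
  unfolding subalgebra_def sets_obs_alg sets_joint_alg by (auto intro!: sigma_sets_mono')

lemma measurable_obs_alg: "int s \<le> k \<Longrightarrow> Y s \<in> borel_measurable (obs_alg M Y k)"
  by (rule measurableI) (auto simp: sets_obs_alg)

lemma measurable_joint_alg: "X t \<in> borel_measurable (joint_alg M X Y t)"
  by (rule measurableI) (auto simp: sets_joint_alg intro!: sigma_sets.Basic)

text \<open>Induction over the generated sigma-algebra. Where \<open>Y t\<close> equals
  \<open>y\<close>, a generator from time \<open>t\<close> is everything or nothing, according to
  whether \<open>y\<close> lies in \<open>S\<close>; earlier generators already belong to the past.
  This supplies \<open>trace\<close> in \<open>cond_exp_Bayes\<close>.\<close>

lemma obs_alg_trace:
  assumes "A \<in> sets (obs_alg M Y (int t))"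
  shows "\<exists>B\<in>sets (obs_alg M Y (int t - 1)). \<forall>\<omega>\<in>space M. Y t \<omega> = y \<longrightarrow> (\<omega> \<in> A \<longleftrightarrow> \<omega> \<in> B)"
  using assms unfolding sets_obs_alg [of M Y "int t"]
proof (induction rule: sigma_sets.induct)
  case (Basic a)
  then obtain s S where a: "a = Y s -` S \<inter> space M" "s \<le> t" "S \<in> sets borel" by auto
  show ?case
  proof (cases "s = t")
    case True
    have "\<forall>\<omega>\<in>space M. Y t \<omega> = y \<longrightarrow> (\<omega> \<in> a \<longleftrightarrow> \<omega> \<in> (if y \<in> S then space M else {}))"
      using a True by auto
    moreover have "(if y \<in> S then space M else {}) \<in> sets (obs_alg M Y (int t - 1))"
      using sets.top[of "obs_alg M Y (int t - 1)"] by simp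
    ultimately show ?thesis by blast
  next
    case False
    then have "a \<in> sets (obs_alg M Y (int t - 1))"
      using a unfolding sets_obs_alg by (intro sigma_sets.Basic) force
    then show ?thesis by blast
  qed
next
  case Empty
  show ?case by (rule bexI[of _ "{}"]) auto
next
  case (Compl a)
  then obtain B where B: "B \<in> sets (obs_alg M Y (int t - 1))"
    "\<forall>\<omega>\<in>space M. Y t \<omega> = y \<longrightarrow> (\<omega> \<in> a \<longleftrightarrow> \<omega> \<in> B)" by blast
  then have "space M - B \<in> sets (obs_alg M Y (int t - 1))"
    using sets.compl_sets[OF B(1)] by simp
  with B(2) show ?case by (intro bexI[of _ "space M - B"]) auto
next
  case (Union a)
  then obtain B where "\<And>i. B i \<in> sets (obs_alg M Y (int t - 1))"
    "\<And>i. \<forall>\<omega>\<in>space M. Y t \<omega> = y \<longrightarrow> (\<omega> \<in> a i \<longleftrightarrow> \<omega> \<in> B i)" by metis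
  then show ?case by (intro bexI[of _ "\<Union>i. B i"]) auto
qed

section \<open>The matrices of the model\<close>

lemma stack_blocks_mult_component: "(stack_blocks R *v x) $ (j, i) = (R j *v x) $ i"
  by (simp add: stack_blocks_def matrix_vector_mult_def)

text \<open>Row \<open>j\<close> of \<open>id_kron_ones\<close> has ones exactly in block
  \<open>j\<close>, so the product collects column sums of \<open>R j\<close>. In the model these
  are the probabilities of observing the \<open>j\<close>-th symbol in state
  \<open>k\<close>.\<close>

lemma id_kron_ones_stack_blocks:
  "(id_kron_ones ** stack_blocks R) $ j $ k = (\<Sum>i\<in>UNIV. R j $ i $ k)"
proof -
  have "(id_kron_ones ** stack_blocks R) $ j $ k
      = (\<Sum>p\<in>UNIV \<times> UNIV. (if fst p = j then R (fst p) $ snd p $ k else 0))"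
    by (auto simp: matrix_matrix_mult_def id_kron_ones_def stack_blocks_def drop_unit_snd_def
        kron_def rowvector_def mat_def intro!: sum.cong)
  also have "\<dots> = (\<Sum>q\<in>UNIV. \<Sum>i\<in>UNIV. if q = j then R q $ i $ k else 0)"
    by (simp add: sum.cartesian_product case_prod_unfold)
  also have "\<dots> = (\<Sum>q\<in>UNIV. if q = j then \<Sum>i\<in>UNIV. R q $ i $ k else 0)"
    by (rule sum.cong) auto
  finally show ?thesis by simp
qed

text \<open>Links the two formulas of the theorem: the denominators of the predictor recursion are
  the entries of \<open>G *v x\<close>.\<close>

lemma id_kron_ones_stack_blocks_mult:
  "((id_kron_ones ** stack_blocks R) *v x) $ j = 1 \<bullet> (R j *v x)"
proof -
  have "((id_kron_ones ** stack_blocks R) *v x) $ j = (\<Sum>k\<in>UNIV. \<Sum>i\<in>UNIV. R j $ i $ k * x $ k)"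
    by (simp add: matrix_vector_mult_def id_kron_ones_stack_blocks sum_distrib_right)
  also have "\<dots> = 1 \<bullet> (R j *v x)"
    by (subst sum.swap) (simp add: matrix_vector_mult_def inner_vec_def)
  finally show ?thesis .
qed

lemma matrix_vector_mult_axis: "((A :: real ^ 'n ^ 'm) *v axis j 1) $ i = A $ i $ j"
  by (simp add: matrix_vector_mult_basis column_def)

lemma diag_mult_component: "(diag v ** A) $ i $ j = v $ i * A $ i $ j"
  by (simp add: matrix_matrix_mult_def diag_def if_distrib[of "\<lambda>x. x * _"] cong: if_cong)

lemma mult_diag_component: "(A ** diag v) $ i $ j = A $ i $ j * v $ j"
  by (simp add: matrix_matrix_mult_def diag_def if_distrib[of "\<lambda>x. _ * x"] cong: if_cong)

section \<open>Prediction and filtering\<close>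

text \<open>\<open>Y t \<omega> $ j\<close> is the indicator of the \<open>j\<close>-th symbol, so
  \<open>transition\<close> is the block interpretation of \<open>R j\<close>, read
  entrywise.\<close>

locale hidden_chain = prob_space M
  for M :: "'a measure" +
  fixes X :: "nat \<Rightarrow> 'a \<Rightarrow> real ^ 'n"
    and Y :: "nat \<Rightarrow> 'a \<Rightarrow> real ^ 'm"
    and R :: "'m \<Rightarrow> real ^ 'n ^ 'n"
  assumes X_meas [measurable]: "\<And>t. X t \<in> borel_measurable M"
    and Y_meas [measurable]: "\<And>t. Y t \<in> borel_measurable M"
    and X_basis: "\<And>t \<omega>. \<omega> \<in> space M \<Longrightarrow> X t \<omega> \<in> range (\<lambda>i. axis i 1)"
    and Y_basis: "\<And>t \<omega>. \<omega> \<in> space M \<Longrightarrow> Y t \<omega> \<in> range (\<lambda>j. axis j 1)"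
    and transition: "\<And>t j i. AE \<omega> in M.
      real_cond_exp M (joint_alg M X Y t) (\<lambda>\<omega>. Y t \<omega> $ j * X (Suc t) \<omega> $ i) \<omega> = (R j *v X t \<omega>) $ i"
begin

definition predictor :: "nat \<Rightarrow> 'a \<Rightarrow> real ^ 'n" where
  "predictor t = vec_cond_exp M (obs_alg M Y (int t - 1)) (X t)"

section \<open>Entries of the state and observation vectors\<close>

lemma component_measurable [measurable]:
  "(\<lambda>\<omega>. X t \<omega> $ i) \<in> borel_measurable M" "(\<lambda>\<omega>. Y t \<omega> $ j) \<in> borel_measurable M"
  using X_meas[of t] Y_meas[of t] by (auto intro!: borel_measurable_vec_nth)

lemma component_01:
  assumes "\<omega> \<in> space M"
  shows "X t \<omega> $ i \<in> {0, 1}" "Y t \<omega> $ j \<in> {0, 1}"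
  using X_basis[OF assms, of t] Y_basis[OF assms, of t] by (auto simp: axis_def)

lemma component_integrable:
  "integrable M (\<lambda>\<omega>. X t \<omega> $ i)" "integrable M (\<lambda>\<omega>. Y t \<omega> $ j)"
  "integrable M (\<lambda>\<omega>. Y t \<omega> $ j * X s \<omega> $ i)" "integrable M (\<lambda>\<omega>. X s \<omega> $ i * Y t \<omega> $ j)"
proof -
  have [simp]: "\<bar>X t \<omega> $ i\<bar> \<le> 1" "\<bar>Y t \<omega> $ j\<bar> \<le> 1" if "\<omega> \<in> space M" for t \<omega> i j
    using component_01[OF that, of t] by (metis abs_0 abs_1 empty_iff insert_iff order_refl zero_le_one)+
  show "integrable M (\<lambda>\<omega>. X t \<omega> $ i)" "integrable M (\<lambda>\<omega>. Y t \<omega> $ j)"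
    "integrable M (\<lambda>\<omega>. Y t \<omega> $ j * X s \<omega> $ i)" "integrable M (\<lambda>\<omega>. X s \<omega> $ i * Y t \<omega> $ j)"
    by (auto intro!: integrable_const_bound[of _ 1] AE_I2 mult_le_one simp: abs_mult)
qed

section \<open>From the joint history to the past observations\<close>

lemma obs_alg_sigma_finite: "sigma_finite_subalgebra M (obs_alg M Y k)"
  and joint_alg_sigma_finite: "sigma_finite_subalgebra M (joint_alg M X Y t)"
  by (simp_all add: sigma_finite_subalgebra subalgebra_obs_alg subalgebra_joint_alg)

lemma tower:
  assumes f: "integrable M f"
    and g: "g \<in> borel_measurable M" "AE \<omega> in M. real_cond_exp M (joint_alg M X Y t) f \<omega> = g \<omega>"
  shows "AE \<omega> in M. real_cond_exp M (obs_alg M Y (int t - 1)) f \<omega>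
      = real_cond_exp M (obs_alg M Y (int t - 1)) g \<omega>"
proof -
  interpret sigma_finite_subalgebra M "obs_alg M Y (int t - 1)" by (rule obs_alg_sigma_finite)
  have "AE \<omega> in M. real_cond_exp M (obs_alg M Y (int t - 1)) (real_cond_exp M (joint_alg M X Y t) f) \<omega>
      = real_cond_exp M (obs_alg M Y (int t - 1)) f \<omega>"
    by (intro real_cond_exp_nested_subalg f subalgebra_joint_alg X_meas Y_meas subalgebra_joint_obs_alg)
  moreover have "AE \<omega> in M.
      real_cond_exp M (obs_alg M Y (int t - 1)) (real_cond_exp M (joint_alg M X Y t) f) \<omega>
      = real_cond_exp M (obs_alg M Y (int t - 1)) g \<omega>"
    by (intro real_cond_exp_cong g) simp
  ultimately show ?thesis by eventually_elim simp
qed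

text \<open>The tower property applied to \<open>transition\<close>, followed by linearity, replaces
  the state by its predictor. This is the numerator in the predictor recursion.\<close>

lemma joint_prediction:
  "AE \<omega> in M. real_cond_exp M (obs_alg M Y (int t - 1)) (\<lambda>\<omega>. Y t \<omega> $ j * X (Suc t) \<omega> $ i) \<omega>
     = (R j *v predictor t \<omega>) $ i"
proof -
  interpret sigma_finite_subalgebra M "obs_alg M Y (int t - 1)" by (rule obs_alg_sigma_finite)
  have "(\<lambda>\<omega>. (R j *v X t \<omega>) $ i) \<in> borel_measurable M"
    unfolding matrix_vector_mult_def by simp
  from tower[OF component_integrable(3) this transition]
    cond_exp_matrix_vector_mult[OF component_integrable(1), of "R j" t i]
  show ?thesis
    unfolding predictor_def by eventually_elim simp
qed

section \<open>Prediction of the current observation\<close>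

lemma sum_X: "\<omega> \<in> space M \<Longrightarrow> (\<Sum>i\<in>UNIV. X t \<omega> $ i) = 1"
  using X_basis[of \<omega> t] by (auto simp: axis_def)

text \<open>The entries of the next state sum to one, so summing over them recovers the observation.
  The algebra \<open>F\<close> is left general to serve both the joint history and the observed
  past.\<close>

lemma observation_decomposition:
  assumes "sigma_finite_subalgebra M F"
  shows "AE \<omega> in M. real_cond_exp M F (\<lambda>\<omega>. Y t \<omega> $ j) \<omega>
     = (\<Sum>i\<in>UNIV. real_cond_exp M F (\<lambda>\<omega>. Y t \<omega> $ j * X (Suc t) \<omega> $ i) \<omega>)"
proof -
  interpret sigma_finite_subalgebra M F by (rule assms)
  have "AE \<omega> in M. real_cond_exp M F (\<lambda>\<omega>. Y t \<omega> $ j) \<omega>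
      = real_cond_exp M F (\<lambda>\<omega>. \<Sum>i\<in>UNIV. Y t \<omega> $ j * X (Suc t) \<omega> $ i) \<omega>"
    by (intro real_cond_exp_cong AE_I2) (auto simp: sum_X simp flip: sum_distrib_left)
  moreover have "AE \<omega> in M. real_cond_exp M F (\<lambda>\<omega>. \<Sum>i\<in>UNIV. Y t \<omega> $ j * X (Suc t) \<omega> $ i) \<omega>
      = (\<Sum>i\<in>UNIV. real_cond_exp M F (\<lambda>\<omega>. Y t \<omega> $ j * X (Suc t) \<omega> $ i) \<omega>)"
    by (rule real_cond_exp_sum) (rule component_integrable)
  ultimately show ?thesis by eventually_elim simp
qed

lemma observation_transition:
  "AE \<omega> in M. real_cond_exp M (joint_alg M X Y t) (\<lambda>\<omega>. Y t \<omega> $ j) \<omega> = 1 \<bullet> (R j *v X t \<omega>)"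
proof -
  have "AE \<omega> in M. \<forall>i\<in>UNIV. real_cond_exp M (joint_alg M X Y t)
      (\<lambda>\<omega>. Y t \<omega> $ j * X (Suc t) \<omega> $ i) \<omega> = (R j *v X t \<omega>) $ i"
    by (intro AE_finite_allI transition) simp
  with observation_decomposition[OF joint_alg_sigma_finite, of t t j]
  show ?thesis by eventually_elim (simp add: inner_vec_def)
qed

lemma observation_prediction:
  "AE \<omega> in M. real_cond_exp M (obs_alg M Y (int t - 1)) (\<lambda>\<omega>. Y t \<omega> $ j) \<omega>
     = 1 \<bullet> (R j *v predictor t \<omega>)"
proof -
  have "AE \<omega> in M. \<forall>i\<in>UNIV. real_cond_exp M (obs_alg M Y (int t - 1))
      (\<lambda>\<omega>. Y t \<omega> $ j * X (Suc t) \<omega> $ i) \<omega> = (R j *v predictor t \<omega>) $ i"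
    by (intro AE_finite_allI joint_prediction) simp
  with observation_decomposition[OF obs_alg_sigma_finite, of "int t - 1" t j]
  show ?thesis by eventually_elim (simp add: inner_vec_def)
qed

text \<open>The state at time \<open>t\<close> is known to the joint history and can be pulled out
  of the conditional expectation there, before descending to the observed past.\<close>

lemma current_prediction:
  "AE \<omega> in M. real_cond_exp M (obs_alg M Y (int t - 1)) (\<lambda>\<omega>. Y t \<omega> $ j * X t \<omega> $ i) \<omega>
     = (id_kron_ones ** stack_blocks R) $ j $ i * predictor t \<omega> $ i"
proof -
  let ?g = "(id_kron_ones ** stack_blocks R) $ j $ i"
  interpret G: sigma_finite_subalgebra M "joint_alg M X Y t" by (rule joint_alg_sigma_finite)
  interpret sigma_finite_subalgebra M "obs_alg M Y (int t - 1)" by (rule obs_alg_sigma_finite)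
  have "(\<lambda>\<omega>. X t \<omega> $ i) \<in> borel_measurable (joint_alg M X Y t)"
    using measurable_joint_alg by (rule borel_measurable_vec_nth)
  then have "AE \<omega> in M. real_cond_exp M (joint_alg M X Y t) (\<lambda>\<omega>. X t \<omega> $ i * Y t \<omega> $ j) \<omega>
      = X t \<omega> $ i * real_cond_exp M (joint_alg M X Y t) (\<lambda>\<omega>. Y t \<omega> $ j) \<omega>"
    by (rule G.real_cond_exp_mult) (simp_all add: component_integrable)
  moreover note observation_transition[of t j]
  ultimately have "AE \<omega> in M. real_cond_exp M (joint_alg M X Y t) (\<lambda>\<omega>. X t \<omega> $ i * Y t \<omega> $ j) \<omega>
      = ?g * X t \<omega> $ i"
    using AE_space
  proof eventually_elim
    case (elim \<omega>)
    \<comment> \<open>With the state at basis vector \<open>k\<close>, the observation probability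
      is entry \<open>(j, k)\<close> of \<open>G\<close>; the factor \<open>X t \<omega> $ i\<close>
      vanishes unless \<open>i = k\<close>, so \<open>k\<close> may be replaced by
      \<open>i\<close>.\<close>
    obtain k where k: "X t \<omega> = axis k 1" using X_basis[OF elim(3)] by blast
    have "1 \<bullet> (R j *v X t \<omega>) = (id_kron_ones ** stack_blocks R) $ j $ k"
      by (simp add: k matrix_vector_mult_axis flip: id_kron_ones_stack_blocks_mult)
    with elim k show ?case by (auto simp: axis_def)
  qed
  from tower[OF component_integrable(4) _ this]
    real_cond_exp_cmult[OF component_integrable(1), of ?g t i]
  show ?thesis
    by (auto simp: predictor_def vec_cond_exp_def mult.commute[of "Y t _ $ j"])
qed

text \<open>Almost surely no observation selects a column whose denominator is zero.\<close>

lemma observed_component_nonzero: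
  "AE \<omega> in M. Y t \<omega> = axis j 1 \<longrightarrow> 1 \<bullet> (R j *v predictor t \<omega>) \<noteq> 0"
proof -
  have "AE \<omega> in M. Y t \<omega> $ j = 1 \<longrightarrow>
      real_cond_exp M (obs_alg M Y (int t - 1)) (\<lambda>\<omega>. Y t \<omega> $ j) \<omega> \<noteq> 0"
    by (rule cond_exp_event_nonzero[of "obs_alg M Y (int t)"])
       (use component_01 in \<open>auto intro!: subalgebra_obs_alg subalgebra_obs_alg_mono
          borel_measurable_vec_nth measurable_obs_alg\<close>)
  with observation_prediction[of t j] show ?thesis
    by eventually_elim auto
qed

lemma Bayes:
  assumes "integrable M Z"
  shows "AE \<omega> in M. Y t \<omega> = axis j 1 \<longrightarrow>
      real_cond_exp M (obs_alg M Y (int t)) Z \<omega> * (1 \<bullet> (R j *v predictor t \<omega>))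
      = real_cond_exp M (obs_alg M Y (int t - 1)) (\<lambda>\<omega>. Y t \<omega> $ j * Z \<omega>) \<omega>"
proof -
  \<comment> \<open>\<open>obs_alg_trace\<close> speaks of a value of the vector,
    \<open>cond_exp_Bayes\<close> of an indicator; for basis vectors the two events
    coincide.\<close>
  have eq: "Y t \<omega> $ j = 1 \<longleftrightarrow> Y t \<omega> = axis j 1" if "\<omega> \<in> space M" for \<omega>
    using Y_basis[OF that, of t] by (auto simp: axis_eq_axis) (auto simp: axis_def split: if_splits)
  have "AE \<omega> in M. Y t \<omega> $ j = 1 \<longrightarrow>
      real_cond_exp M (obs_alg M Y (int t)) Z \<omega>
        * real_cond_exp M (obs_alg M Y (int t - 1)) (\<lambda>\<omega>. Y t \<omega> $ j) \<omega>
      = real_cond_exp M (obs_alg M Y (int t - 1)) (\<lambda>\<omega>. Y t \<omega> $ j * Z \<omega>) \<omega>"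
  proof (rule cond_exp_Bayes[OF _ _ _ _ _ assms])
    show "\<exists>B\<in>sets (obs_alg M Y (int t - 1)). \<forall>\<omega>\<in>space M. Y t \<omega> $ j = 1 \<longrightarrow> (\<omega> \<in> A \<longleftrightarrow> \<omega> \<in> B)"
      if "A \<in> sets (obs_alg M Y (int t))" for A
      using obs_alg_trace[OF that, of "axis j 1"] eq by auto
  qed (use component_01 in \<open>auto intro!: subalgebra_obs_alg subalgebra_obs_alg_mono
          borel_measurable_vec_nth measurable_obs_alg\<close>)
  with observation_prediction[of t j] show ?thesis
    by eventually_elim auto
qed

section \<open>Initial condition, predictor recursion and filter\<close>

lemma predictor_initial: "AE \<omega> in M. predictor 0 \<omega> = integral\<^sup>L M (X 0)"
proof -
  let ?F = "obs_alg M Y (int 0 - 1)"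
  interpret sigma_finite_subalgebra M ?F by (rule obs_alg_sigma_finite)
  have "integrable M (X 0)"
  proof (rule integrable_const_bound[of _ 1])
    show "AE \<omega> in M. norm (X 0 \<omega>) \<le> 1"
      using X_basis[of _ 0] by (intro AE_I2) (metis imageE norm_axis_1 order_refl)
  qed simp
  then have comp: "integral\<^sup>L M (X 0) $ i = (\<integral>\<omega>. X 0 \<omega> $ i \<partial>M)" for i
    using integral_inner_left[of "axis i 1" M "X 0"] by (simp add: inner_axis)
  have "AE \<omega> in M. real_cond_exp M ?F (\<lambda>\<omega>. X 0 \<omega> $ i) \<omega> = integral\<^sup>L M (X 0) $ i" for i
  proof (rule real_cond_exp_charact[OF _ component_integrable(1)])
    fix A assume "A \<in> sets ?F"
    \<comment> \<open>At time \<open>-1\<close> the algebra is trivial, so the constant candidate is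
      tested on two sets only.\<close>
    then consider "A = {}" | "A = space M" by (auto simp: sets_obs_alg_minus_one)
    then show "(\<integral>\<omega>\<in>A. X 0 \<omega> $ i \<partial>M) = (\<integral>\<omega>\<in>A. integral\<^sup>L M (X 0) $ i \<partial>M)"
      by cases
        (simp add: set_lebesgue_integral_def,
         simp add: comp set_integral_space component_integrable prob_space)
  qed simp_all
  then have "AE \<omega> in M. \<forall>i\<in>UNIV. real_cond_exp M ?F (\<lambda>\<omega>. X 0 \<omega> $ i) \<omega> = integral\<^sup>L M (X 0) $ i"
    by (intro AE_finite_allI) simp_all
  then show ?thesis
    by eventually_elim (simp add: predictor_def vec_cond_exp_def vec_eq_iff)
qed

text \<open>\<open>Bayes\<close> for the entries of the next state, with numerator from
  \<open>joint_prediction\<close>; multiplication by the observed basis vector selects the matching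
  column.\<close>

lemma predictor_step:
  "AE \<omega> in M. predictor (Suc t) \<omega> = normalized_columns (c \<omega>) R (predictor t \<omega>) *v Y t \<omega>"
proof -
  have "AE \<omega> in M. \<forall>j\<in>UNIV. Y t \<omega> = axis j 1 \<longrightarrow> 1 \<bullet> (R j *v predictor t \<omega>) \<noteq> 0"
    by (intro AE_finite_allI observed_component_nonzero) simp
  moreover have "AE \<omega> in M. \<forall>j\<in>UNIV. \<forall>i\<in>UNIV. Y t \<omega> = axis j 1 \<longrightarrow>
      real_cond_exp M (obs_alg M Y (int t)) (\<lambda>\<omega>. X (Suc t) \<omega> $ i) \<omega> * (1 \<bullet> (R j *v predictor t \<omega>))
      = real_cond_exp M (obs_alg M Y (int t - 1)) (\<lambda>\<omega>. Y t \<omega> $ j * X (Suc t) \<omega> $ i) \<omega>"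
    by (intro AE_finite_allI Bayes component_integrable) simp_all
  moreover have "AE \<omega> in M. \<forall>j\<in>UNIV. \<forall>i\<in>UNIV. real_cond_exp M (obs_alg M Y (int t - 1))
      (\<lambda>\<omega>. Y t \<omega> $ j * X (Suc t) \<omega> $ i) \<omega> = (R j *v predictor t \<omega>) $ i"
    by (intro AE_finite_allI joint_prediction) simp_all
  ultimately show ?thesis
    using AE_space
  proof eventually_elim
    case (elim \<omega>)
    obtain j where j: "Y t \<omega> = axis j 1" using Y_basis[OF elim(4)] by blast
    \<comment> \<open>\<open>int (Suc t) - 1\<close> is \<open>int t\<close>, so this predictor
      conditions on exactly the algebra treated by \<open>Bayes\<close>.\<close>
    have "predictor (Suc t) \<omega> $ i = (R j *v predictor t \<omega>) $ i / (1 \<bullet> (R j *v predictor t \<omega>))" for i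
      using elim(1-3) j by (simp add: predictor_def[of "Suc t"] vec_cond_exp_def eq_divide_eq)
    then show ?case
      using elim(1) j
      by (intro iffD2[OF vec_eq_iff] allI)
         (simp add: matrix_vector_mult_axis normalized_columns_def)
  qed
qed

lemma observation_predictor:
  "AE \<omega> in M. vec_cond_exp M (obs_alg M Y (int t - 1)) (Y t) \<omega>
     = (id_kron_ones ** stack_blocks R) *v predictor t \<omega>"
proof -
  have "AE \<omega> in M. \<forall>j\<in>UNIV. real_cond_exp M (obs_alg M Y (int t - 1)) (\<lambda>\<omega>. Y t \<omega> $ j) \<omega>
     = 1 \<bullet> (R j *v predictor t \<omega>)"
    by (intro AE_finite_allI observation_prediction) simp
  then show ?thesis
    by eventually_elim (simp add: vec_cond_exp_def vec_eq_iff id_kron_ones_stack_blocks_mult)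
qed

text \<open>\<open>Bayes\<close> for the entries of the current state, with numerator from
  \<open>current_prediction\<close>. The selected diagonal entry is a true inverse, so
  \<open>d\<close> drops out. The theorem uses the instance \<open>Suc t\<close>.\<close>

lemma filter_step:
  "AE \<omega> in M. vec_cond_exp M (obs_alg M Y (int t)) (X t) \<omega>
     = (diag (predictor t \<omega>) ** transpose (id_kron_ones ** stack_blocks R)
         ** diag_inv (d \<omega>) (vec_cond_exp M (obs_alg M Y (int t - 1)) (Y t) \<omega>)) *v Y t \<omega>"
proof -
  have "AE \<omega> in M. \<forall>j\<in>UNIV. Y t \<omega> = axis j 1 \<longrightarrow> 1 \<bullet> (R j *v predictor t \<omega>) \<noteq> 0"
    by (intro AE_finite_allI observed_component_nonzero) simp
  moreover have "AE \<omega> in M. \<forall>j\<in>UNIV. \<forall>i\<in>UNIV. Y t \<omega> = axis j 1 \<longrightarrow>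
      real_cond_exp M (obs_alg M Y (int t)) (\<lambda>\<omega>. X t \<omega> $ i) \<omega> * (1 \<bullet> (R j *v predictor t \<omega>))
      = real_cond_exp M (obs_alg M Y (int t - 1)) (\<lambda>\<omega>. Y t \<omega> $ j * X t \<omega> $ i) \<omega>"
    by (intro AE_finite_allI Bayes component_integrable) simp_all
  moreover have "AE \<omega> in M. \<forall>j\<in>UNIV. \<forall>i\<in>UNIV. real_cond_exp M (obs_alg M Y (int t - 1))
      (\<lambda>\<omega>. Y t \<omega> $ j * X t \<omega> $ i) \<omega>
      = (id_kron_ones ** stack_blocks R) $ j $ i * predictor t \<omega> $ i"
    by (intro AE_finite_allI current_prediction) simp_all
  moreover note observation_predictor[of t]
  ultimately show ?thesis
    using AE_space
  proof eventually_elim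
    case (elim \<omega>)
    obtain j where j: "Y t \<omega> = axis j 1" using Y_basis[OF elim(5)] by blast
    have "real_cond_exp M (obs_alg M Y (int t)) (\<lambda>\<omega>. X t \<omega> $ i) \<omega>
        = (id_kron_ones ** stack_blocks R) $ j $ i * predictor t \<omega> $ i
          / (1 \<bullet> (R j *v predictor t \<omega>))" for i
      using elim(1-3) j by (simp add: eq_divide_eq)
    then show ?case
      using elim(1) j
      by (intro iffD2[OF vec_eq_iff] allI)
         (simp add: vec_cond_exp_def[of M "obs_alg M Y (int t)"] matrix_vector_mult_axis
          diag_inv_def mult_diag_component diag_mult_component transpose_def elim(4)
          id_kron_ones_stack_blocks_mult divide_inverse mult_ac)
  qed
qed

end

text \<open>The convention on zeros is expressed by arbitrary \<open>c\<close> and \<open>d\<close>,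
  which may vary with time and outcome. The truncated subtraction in \<open>W\<close> is harmless,
  since both assumptions on \<open>W\<close> concern times from 1 on.\<close>

theorem theorem5p3:
  fixes M :: "'a measure"
    and X :: "nat \<Rightarrow> 'a \<Rightarrow> real ^ 'n"
    and Y :: "nat \<Rightarrow> 'a \<Rightarrow> real ^ 'm"
    and R :: "'m \<Rightarrow> real ^ 'n ^ 'n"
    and c :: "nat \<Rightarrow> 'a \<Rightarrow> real ^ 'm ^ 'n"
    and d :: "nat \<Rightarrow> 'a \<Rightarrow> real ^ 'm"
  defines "W \<equiv> (\<lambda>t \<omega>. kron_vec (Y (t - 1) \<omega>) (X t \<omega>))"
    and "Rbar \<equiv> stack_blocks R"
    and "G \<equiv> id_kron_ones ** stack_blocks R"
    and "Xpred \<equiv> (\<lambda>t. vec_cond_exp M (obs_alg M Y (int t - 1)) (X t))"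
    and "Xfilt \<equiv> (\<lambda>t. vec_cond_exp M (obs_alg M Y (int t)) (X t))"
    and "Ypred \<equiv> (\<lambda>t. vec_cond_exp M (obs_alg M Y (int t - 1)) (Y t))"
  assumes "prob_space M"
    and "\<And>t. X t \<in> borel_measurable M"
    and "\<And>t. Y t \<in> borel_measurable M"
    and "\<And>t \<omega>. \<omega> \<in> space M \<Longrightarrow> X t \<omega> \<in> range (\<lambda>i. axis i 1)"
    and "\<And>t \<omega>. \<omega> \<in> space M \<Longrightarrow> Y t \<omega> \<in> range (\<lambda>j. axis j 1)"
    and "markov_wrt M (joint_alg M X Y) 1 W (Rbar ** ones_kron_id)"
    and "\<And>t. AE \<omega> in M. vec_cond_exp M (joint_alg M X Y t) (W (Suc t)) \<omega> = Rbar *v X t \<omega>"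
  shows "AE \<omega> in M.
      Xpred 0 \<omega> = integral\<^sup>L M (X 0) \<and>
      (\<forall>t. Xpred (Suc t) \<omega> = normalized_columns (c t \<omega>) R (Xpred t \<omega>) *v Y t \<omega> \<and>
           Xfilt (Suc t) \<omega> =
             (diag (Xpred (Suc t) \<omega>) ** transpose G ** diag_inv (d t \<omega>) (Ypred (Suc t) \<omega>))
               *v Y (Suc t) \<omega> \<and>
           Ypred (Suc t) \<omega> = G *v Xpred (Suc t) \<omega>)"
proof -
  have "hidden_chain M X Y R"
  proof (intro hidden_chain.intro hidden_chain_axioms.intro)
    fix t j i
    show "AE \<omega> in M. real_cond_exp M (joint_alg M X Y t) (\<lambda>\<omega>. Y t \<omega> $ j * X (Suc t) \<omega> $ i) \<omega>
        = (R j *v X t \<omega>) $ i"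
      using assms(13)[of t]
    proof eventually_elim
      case (elim \<omega>)
      \<comment> \<open>Since \<open>Suc t - 1 = t\<close>, entry \<open>(j, i)\<close> of
        \<open>W (Suc t)\<close> pairs the current observation with the next state.\<close>
      then have "vec_cond_exp M (joint_alg M X Y t) (W (Suc t)) \<omega> $ (j, i)
          = (Rbar *v X t \<omega>) $ (j, i)" by simp
      then show ?case
        by (simp add: vec_cond_exp_def W_def kron_vec_def Rbar_def stack_blocks_mult_component)
    qed
  qed (use assms(7-11) in auto)
  then interpret hidden_chain M X Y R .
  have pred: "Xpred t = predictor t" for t
    by (simp add: Xpred_def predictor_def)
  \<comment> \<open>Times are countable, so one null set serves all of them.\<close>
  have "AE \<omega> in M. \<forall>t. Xpred (Suc t) \<omega> = normalized_columns (c t \<omega>) R (Xpred t \<omega>) *v Y t \<omega>"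
    unfolding pred AE_all_countable by (intro allI predictor_step)
  moreover have "AE \<omega> in M. \<forall>t. Xfilt (Suc t) \<omega> =
      (diag (Xpred (Suc t) \<omega>) ** transpose G ** diag_inv (d t \<omega>) (Ypred (Suc t) \<omega>)) *v Y (Suc t) \<omega>"
    unfolding pred G_def Xfilt_def Ypred_def AE_all_countable by (intro allI filter_step)
  moreover have "AE \<omega> in M. \<forall>t. Ypred (Suc t) \<omega> = G *v Xpred (Suc t) \<omega>"
    unfolding pred G_def Ypred_def AE_all_countable by (intro allI observation_predictor)
  moreover have "AE \<omega> in M. Xpred 0 \<omega> = integral\<^sup>L M (X 0)"
    unfolding pred by (rule predictor_initial)
  ultimately show ?thesis by eventually_elim auto
qed

end
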